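(* We have $$\frac{(1-t)(1+t\exp_{q}(x))}{1-t^{2}\exp_{q}(x)\mathrm{Exp}_{q}(yx)}=1+t(1+yt)\sum_{n=1}^{\infty}\frac{(1+yt^{2})^{n-1}}{(1-t^{2})^{n}}\,P_{n}^{(\mathrm{inv},\mathrm{lpk},\mathrm{val},\mathrm{des})}\left(q,\alpha,\beta,\gamma\right)\frac{x^{n}}{[n]_{q}!},$$ where $$\alpha=\frac{t(1+y)(y+t)}{(y+t^{2})(1+yt)},\qquad \beta=\frac{t(1+y)(1+yt)}{(1+yt^{2})(y+t)},\qquad \gamma=\frac{y+t^{2}}{1+yt^{2}}.$$
   Context: $\mathfrak{S}_n$ is the set of permutations $\pi=\pi_1\cdots\pi_n$ of $[n]=\{1,\dots,n\}$. For $\pi\in\mathfrak{S}_n$: $\mathrm{des}(\pi)$ is the number of $i\in[n-1]$ with $\pi_i>\pi_{i+1}$; $\mathrm{lpk}(\pi)$ is the number of left peaks, where $i\in[n-1]$ is a left peak if either $2\le i\le n-1$ and $\pi_{i-1}<\pi_i>\pi_{i+1}$, or $i=1$ and $\pi_1>\pi_2$; $\mathrm{val}(\pi)$ is the number of valleys, i.e. of $i$ with $2\le i\le n-1$ and $\pi_{i-1}>\pi_i<\pi_{i+1}$; $\mathrm{inv}(\pi)$ is the number of pairs $(i,j)$ with $1\le i<j\le n$ and $\pi_i>\pi_j$. For $n\ge1$, $P_n^{(\mathrm{inv},\mathrm{lpk},\mathrm{val},\mathrm{des})}(q,y,z,t)=\sum_{\pi\in\mathfrak{S}_n}q^{\mathrm{inv}(\pi)}y^{\mathrm{lpk}(\pi)}z^{\mathrm{val}(\pi)}t^{\mathrm{des}(\pi)}$.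 Also $[n]_q!=(1+q)(1+q+q^2)\cdots(1+q+\cdots+q^{n-1})$ (with $[0]_q!=[1]_q!=1$), $\exp_q(x)=\sum_{n\ge0}\frac{x^n}{[n]_q!}$ and $\mathrm{Exp}_q(x)=\sum_{n\ge0}q^{\binom n2}\frac{x^n}{[n]_q!}$. Here $q,y,t,x$ are indeterminates and the identity is one of formal power series in $x$ whose coefficients are rational functions of $q,y,t$. *)

theory Defs
  imports
    "HOL-Computational_Algebra.Computational_Algebra"
    "HOL-Combinatorics.Permutations"
begin

text \<open>
  A permutation of \<open>{1..n}\<close> is a function \<open>\<pi>\<close> with \<open>\<pi> permutes {1..n}\<close>. Such a function is
  the identity outside \<open>{1..n}\<close>, so the statistics take \<open>n\<close> as an extra argument and
  never look at positions outside \<open>{1..n}\<close>.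
\<close>

definition des :: "nat \<Rightarrow> (nat \<Rightarrow> nat) \<Rightarrow> nat" where
  "des n \<pi> = card {i \<in> {1..n-1}. \<pi> i > \<pi> (i+1)}"

definition lpk :: "nat \<Rightarrow> (nat \<Rightarrow> nat) \<Rightarrow> nat" where
  "lpk n \<pi> = card {i \<in> {1..n-1}.
     (2 \<le> i \<and> \<pi> (i-1) < \<pi> i \<and> \<pi> i > \<pi> (i+1)) \<or> (i = 1 \<and> \<pi> 1 > \<pi> 2)}"

definition val :: "nat \<Rightarrow> (nat \<Rightarrow> nat) \<Rightarrow> nat" where
  "val n \<pi> = card {i \<in> {2..n-1}. \<pi> (i-1) > \<pi> i \<and> \<pi> i < \<pi> (i+1)}"

definition invs :: "nat \<Rightarrow> (nat \<Rightarrow> nat) \<Rightarrow> nat" where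
  "invs n \<pi> = card {(i, j). 1 \<le> i \<and> i < j \<and> j \<le> n \<and> \<pi> i > \<pi> j}"

text \<open>
  The value of the polynomial \<open>P\<^sub>n\<close> at given elements of a commutative (semi)ring.
\<close>

definition P_inv_lpk_val_des :: "nat \<Rightarrow> 'a \<Rightarrow> 'a \<Rightarrow> 'a \<Rightarrow> 'a \<Rightarrow> 'a::comm_semiring_1" where
  "P_inv_lpk_val_des n q y z t =
     (\<Sum>\<pi> | \<pi> permutes {1..n}. q ^ invs n \<pi> * y ^ lpk n \<pi> * z ^ val n \<pi> * t ^ des n \<pi>)"

definition q_fact :: "'a \<Rightarrow> nat \<Rightarrow> 'a::comm_semiring_1" where
  "q_fact q n = (\<Prod>k=1..n. \<Sum>i<k. q ^ i)"

definition q_exp :: "'a \<Rightarrow> 'a::field fps" where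
  "q_exp q = Abs_fps (\<lambda>n. 1 / q_fact q n)"

definition q_Exp :: "'a \<Rightarrow> 'a::field fps" where
  "q_Exp q = Abs_fps (\<lambda>n. q ^ (n choose 2) / q_fact q n)"

text \<open>
  The field of rational functions in three indeterminates over the rationals, as the fraction
  field of the iterated polynomial ring. The innermost polynomial variable is \<open>q\<close>, the
  middle one is \<open>y\<close> and the outermost one is \<open>t\<close>.
\<close>

type_synonym ratfun = "rat poly poly poly fract"

definition ind_q :: ratfun where
  "ind_q = to_fract [:[:[:0, 1:]:]:]"

definition ind_y :: ratfun where
  "ind_y = to_fract [:[:0, 1:]:]"

definition ind_t :: ratfun where
  "ind_t = to_fract [:0, 1:]"

end

(*
  Replacing a permutation by its inversion code turns inversions into the sum of the entries and
  descents into strict descents of the code, whose entries are otherwise independent. Writing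
  "descent" as "no condition" minus "weak ascent" gives a transfer-matrix recurrence in which the
  "no condition" steps factor through q-binomial coefficients and have rank one, while the
  remaining steps act by the difference of the ascent and descent matrices. For the given alpha,
  beta, gamma and the scaling (1 + y t^2) / (1 - t^2) this 2x2 difference has eigenvalues 1 and -y.
  The two left eigenvectors yield two linear equations for the generating functions, with
  coefficients exp_q(x) and exp_q(-yx) = 1 / Exp_q(yx), and eliminating gives the identity.
*)

theory Submission
  imports Defs
begin

section \<open>Inversion codes\<close>

text \<open>The parameter is the largest index, so a code has \<open>k + 1\<close> entries and
  always a front letter \<open>d k\<close>. Extensionality keeps the set finite.\<close>

definition codes :: "nat \<Rightarrow> (nat \<Rightarrow> nat) set" where
  "codes k = PiE {..k} (\<lambda>j. {..j})"

text \<open>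
  Codes are indexed from the right end of the permutation: \<open>perm_code n \<pi> j\<close> belongs to
  position \<open>n - j\<close>, so that prepending a letter extends the code at the new index.
\<close>

definition perm_code :: "nat \<Rightarrow> (nat \<Rightarrow> nat) \<Rightarrow> nat \<Rightarrow> nat" where
  "perm_code n \<pi> = restrict (\<lambda>j. card {i \<in> {n-j<..n}. \<pi> i < \<pi> (n-j)}) {..<n}"

lemma finite_codes [simp]: "finite (codes k)"
  unfolding codes_def by (intro finite_PiE) auto

lemma card_codes: "card (codes k) = fact (Suc k)"
proof -
  have "card (codes k) = (\<Prod>j\<le>k. Suc j)"
    unfolding codes_def by (subst card_PiE) auto
  also have "\<dots> = fact (Suc k)"
    by (induction k) (auto simp: algebra_simps)
  finally show ?thesis .
qed

lemma sum_codes_Suc: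
  "(\<Sum>d\<in>codes (Suc k). F d) = (\<Sum>d\<in>codes k. \<Sum>a\<le>Suc k. F (d(Suc k := a)))"
proof -
  have "codes (Suc k) = (\<lambda>(a, d). d(Suc k := a)) ` ({..Suc k} \<times> codes k)"
    unfolding codes_def atMost_Suc[of k] by (subst PiE_insert_eq) auto
  moreover have "inj_on (\<lambda>(a, d). d(Suc k := a)) ({..Suc k} \<times> codes k)"
    using inj_combinator[of "Suc k" "{..k}" "\<lambda>j. {..j}"] unfolding codes_def by auto
  ultimately have "(\<Sum>d\<in>codes (Suc k). F d) = (\<Sum>(a, d)\<in>{..Suc k} \<times> codes k. F (d(Suc k := a)))"
    by (simp add: sum.reindex case_prod_unfold)
  also have "\<dots> = (\<Sum>d\<in>codes k. \<Sum>a\<le>Suc k. F (d(Suc k := a)))"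
    by (subst sum.swap) (simp add: sum.cartesian_product)
  finally show ?thesis .
qed

lemma perm_code_in_codes: "perm_code (Suc k) \<pi> \<in> codes k"
proof -
  have "card {i \<in> {Suc k - j<..Suc k}. \<pi> i < \<pi> (Suc k - j)} \<le> j" if "j \<le> k" for j
  proof -
    have "card {i \<in> {Suc k - j<..Suc k}. \<pi> i < \<pi> (Suc k - j)} \<le> card {Suc k - j<..Suc k}"
      by (intro card_mono) auto
    then show ?thesis using that by simp
  qed
  then show ?thesis
    unfolding codes_def perm_code_def by (auto simp: lessThan_Suc_atMost)
qed

lemma card_less_inj:
  fixes x y :: nat
  assumes "finite R" "x \<in> R" "y \<in> R" "card {z \<in> R. z < x} = card {z \<in> R. z < y}"
  shows "x = y"
proof -
  have less: "card {z \<in> R. z < u} < card {z \<in> R. z < v}" if "u < v" "u \<in> R" for u v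
    using that assms(1) by (intro psubset_card_mono) auto
  show ?thesis
    using less[of x y] less[of y x] assms by (cases x y rule: linorder_cases) auto
qed

lemma code_card_image:
  fixes \<pi> :: "nat \<Rightarrow> nat"
  assumes "\<pi> permutes {1..n}" "i \<in> {1..n}"
  shows "card {l \<in> {i<..n}. \<pi> l < \<pi> i} = card {x \<in> {1..n} - \<pi> ` {1..<i}. x < \<pi> i}"
proof -
  have inj: "inj \<pi>" using assms(1) by (rule permutes_inj)
  have "{1..n} - \<pi> ` {1..<i} = \<pi> ` ({1..n} - {1..<i})"
    using inj permutes_image[OF assms(1)] by (simp add: image_set_diff)
  also have "{1..n} - {1..<i} = {i..n}" using assms(2) by auto
  finally have "{x \<in> {1..n} - \<pi> ` {1..<i}. x < \<pi> i} = \<pi> ` {l \<in> {i<..n}. \<pi> l < \<pi> i}"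
    by (auto simp: image_iff le_less)
  then show ?thesis
    using inj by (simp add: card_image inj_on_subset)
qed

text \<open>Decoding runs from left to right: if the earlier letters agree, both permutations choose
  from the same remaining set \<open>R\<close>, and equal code entries mean equal ranks in
  it.\<close>

lemma perm_code_inj: "inj_on (perm_code n) {\<pi>. \<pi> permutes {1..n}}"
proof (intro inj_onI, clarify)
  fix \<pi> \<sigma> assume p: "\<pi> permutes {1..n}" and s: "\<sigma> permutes {1..n}"
    and eq: "perm_code n \<pi> = perm_code n \<sigma>"
  have "i \<in> {1..n} \<Longrightarrow> \<pi> i = \<sigma> i" for i
  proof (induction i rule: less_induct)
    case (less i)
    define R where "R = {1..n} - \<pi> ` {1..<i}"
    have R': "R = {1..n} - \<sigma> ` {1..<i}"
    proof -
      have "\<pi> ` {1..<i} = \<sigma> ` {1..<i}"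
        using less.IH less.prems by (intro image_cong) auto
      then show ?thesis by (simp only: R_def)
    qed
    have "perm_code n \<pi> (n - i) = perm_code n \<sigma> (n - i)" using eq by simp
    then have "card {l \<in> {i<..n}. \<pi> l < \<pi> i} = card {l \<in> {i<..n}. \<sigma> l < \<sigma> i}"
      using less.prems by (simp add: perm_code_def)
    then have eq': "card {x \<in> R. x < \<pi> i} = card {x \<in> R. x < \<sigma> i}"
      by (simp only: code_card_image[OF p less.prems, folded R_def]
          code_card_image[OF s less.prems, folded R'])
    have p_R: "\<pi> i \<in> R"
      unfolding R_def using permutes_in_image[OF p] permutes_inj[OF p] less.prems
      by (auto dest: injD)
    have s_R: "\<sigma> i \<in> R"
      unfolding R' using permutes_in_image[OF s] permutes_inj[OF s] less.prems
      by (auto dest: injD)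
    have "finite R" by (simp add: R_def)
    then show ?case using p_R s_R eq' by (rule card_less_inj)
  qed
  then show "\<pi> = \<sigma>"
    using p s by (intro ext) (metis permutes_not_in)
qed

text \<open>Injectivity suffices, as both sets have \<open>(k + 1)!\<close> elements.\<close>

lemma perm_code_bij:
  "bij_betw (perm_code (Suc k)) {\<pi>. \<pi> permutes {1..Suc k}} (codes k)"
proof -
  have "perm_code (Suc k) ` {\<pi>. \<pi> permutes {1..Suc k}} \<subseteq> codes k"
    using perm_code_in_codes by auto
  moreover have "card (perm_code (Suc k) ` {\<pi>. \<pi> permutes {1..Suc k}}) = card (codes k)"
    using perm_code_inj[of "Suc k"] card_permutations[of "{1..Suc k}" "Suc k"]
    by (simp add: card_image card_codes)
  ultimately have "perm_code (Suc k) ` {\<pi>. \<pi> permutes {1..Suc k}} = codes k"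
    by (intro card_subset_eq) auto
  then show ?thesis using perm_code_inj by (auto simp: bij_betw_def)
qed

lemma invs_eq_sum_code: "invs n \<pi> = (\<Sum>j<n. perm_code n \<pi> j)"
proof -
  have "{(i, j). 1 \<le> i \<and> i < j \<and> j \<le> n \<and> \<pi> i > \<pi> j}
      = (SIGMA i:{1..n}. {l \<in> {i<..n}. \<pi> l < \<pi> i})"
    by auto
  then have "invs n \<pi> = (\<Sum>i\<in>{1..n}. card {l \<in> {i<..n}. \<pi> l < \<pi> i})"
    by (simp add: invs_def)
  also have "\<dots> = (\<Sum>j<n. perm_code n \<pi> j)"
    by (rule sum.reindex_bij_witness[of _ "\<lambda>j. n - j" "\<lambda>i. n - i"])
      (auto simp: perm_code_def)
  finally show ?thesis .
qed

text \<open>At a descent, whatever is counted for position \<open>i + 1\<close> is also counted for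
  \<open>i\<close>, and so is \<open>i + 1\<close> itself; at an ascent the inclusion
  reverses.\<close>

lemma perm_code_descent:
  assumes "\<pi> permutes {1..n}" "1 \<le> i" "i < n"
  shows "perm_code n \<pi> (n - Suc i) < perm_code n \<pi> (n - i) \<longleftrightarrow> \<pi> (Suc i) < \<pi> i"
proof -
  let ?C = "\<lambda>i. {l \<in> {i<..n}. \<pi> l < \<pi> i}"
  have code: "perm_code n \<pi> (n - Suc i) = card (?C (Suc i))" "perm_code n \<pi> (n - i) = card (?C i)"
    using assms by (auto simp: perm_code_def)
  show ?thesis
  proof (cases "\<pi> (Suc i) < \<pi> i")
    case True
    have "?C (Suc i) \<subseteq> ?C i"
    proof
      fix l assume "l \<in> ?C (Suc i)"
      then show "l \<in> ?C i" using True by simp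
    qed
    moreover have "Suc i \<in> ?C i" "Suc i \<notin> ?C (Suc i)"
      using True assms by simp_all
    ultimately have "?C (Suc i) \<subset> ?C i" by blast
    then show ?thesis unfolding code using True by (simp add: psubset_card_mono)
  next
    case False
    moreover have "\<pi> (Suc i) \<noteq> \<pi> i"
      using permutes_inj[OF assms(1)] by (simp add: inj_eq)
    ultimately have less: "\<pi> i < \<pi> (Suc i)" by simp
    have "?C i \<subseteq> ?C (Suc i)"
    proof
      fix l assume l: "l \<in> ?C i"
      then have "l \<noteq> Suc i" using less by auto
      then show "l \<in> ?C (Suc i)" using l less by auto
    qed
    then have "card (?C i) \<le> card (?C (Suc i))" by (intro card_mono) auto
    then show ?thesis unfolding code using False by simp
  qed
qed

section \<open>Weights of codes\<close>

text \<open>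
  In \<open>step_wt\<close> and \<open>code_wt\<close> the flag \<open>s\<close> tells whether the preceding step was a descent;
  \<open>s = False\<close> at the beginning encodes the convention \<open>\<pi>\<^sub>0 = 0\<close> behind left peaks.
\<close>

definition step_wt :: "'a \<Rightarrow> 'a \<Rightarrow> 'a \<Rightarrow> bool \<Rightarrow> bool \<Rightarrow> 'a::comm_ring_1" where
  "step_wt \<alpha> \<beta> \<gamma> s d = (if d then (if s then \<gamma> else \<alpha> * \<gamma>) else (if s then \<beta> else 1))"

primrec code_wt :: "'a \<Rightarrow> 'a \<Rightarrow> 'a \<Rightarrow> bool \<Rightarrow> nat \<Rightarrow> (nat \<Rightarrow> nat) \<Rightarrow> 'a::comm_ring_1" where
  "code_wt \<alpha> \<beta> \<gamma> s 0 d = 1"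
| "code_wt \<alpha> \<beta> \<gamma> s (Suc k) d =
     step_wt \<alpha> \<beta> \<gamma> s (d k < d (Suc k)) * code_wt \<alpha> \<beta> \<gamma> (d k < d (Suc k)) k d"

lemma code_wt_upd [simp]: "k < j \<Longrightarrow> code_wt \<alpha> \<beta> \<gamma> s k (d(j := a)) = code_wt \<alpha> \<beta> \<gamma> s k d"
  by (induction k arbitrary: s) auto

lemma code_wt_eq_prod:
  "code_wt \<alpha> \<beta> \<gamma> s k d =
     (\<Prod>j<k. step_wt \<alpha> \<beta> \<gamma> (if Suc j = k then s else d (Suc j) < d (Suc (Suc j))) (d j < d (Suc j)))"
proof (induction k arbitrary: s)
  case (Suc k)
  show ?case
    by (simp add: Suc mult.commute) (auto intro!: prod.cong arg_cong2[where f="(*)"])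
qed auto

lemma prod_if_eq_power_card:
  "finite A \<Longrightarrow> (\<Prod>i\<in>A. if P i then x else 1) = (x::'a::comm_monoid_mult) ^ card {i \<in> A. P i}"
  by (simp add: prod.inter_filter[symmetric])

text \<open>A descent not preceded by a descent is a left peak, and an ascent after a descent is a
  valley, so the step weights place \<open>\<alpha>\<close>, \<open>\<beta>\<close>,
  \<open>\<gamma>\<close> exactly where the statistics count.\<close>

lemma code_wt_perm_code:
  assumes p: "\<pi> permutes {1..Suc k}"
  shows "code_wt \<alpha> \<beta> \<gamma> False k (perm_code (Suc k) \<pi>)
       = \<alpha> ^ lpk (Suc k) \<pi> * \<beta> ^ val (Suc k) \<pi> * \<gamma> ^ des (Suc k) \<pi>"
proof -
  define D where "D i \<longleftrightarrow> \<pi> (Suc i) < \<pi> i" for i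
  let ?c = "perm_code (Suc k) \<pi>"
  have neq: "\<pi> i \<noteq> \<pi> (Suc i)" for i
    using permutes_inj[OF p] by (simp add: inj_eq)
  have c: "?c j < ?c (Suc j) \<longleftrightarrow> D (k - j)" if "j < k" for j
    using perm_code_descent[OF p, of "k - j"] that
    by (simp add: D_def Suc_diff_le Suc_diff_Suc)
  have k1: "k - a = Suc 0 \<longleftrightarrow> Suc a = k" if "a < k" for a
    using that by auto
  have "code_wt \<alpha> \<beta> \<gamma> False k ?c =
      (\<Prod>j<k. step_wt \<alpha> \<beta> \<gamma> (Suc j \<noteq> k \<and> D (k - Suc j)) (D (k - j)))"
    unfolding code_wt_eq_prod by (intro prod.cong) (auto simp: c)
  \<comment> \<open>Code indices run against positions: \<open>i = k - j\<close>.\<close>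
  also have "\<dots> = (\<Prod>i\<in>{1..k}. step_wt \<alpha> \<beta> \<gamma> (i \<noteq> 1 \<and> D (i - 1)) (D i))"
    by (rule prod.reindex_bij_witness[of _ "\<lambda>i. k - i" "\<lambda>j. k - j"])
      (auto simp: Suc_diff_le k1)
  also have "\<dots> = (\<Prod>i\<in>{1..k}. (if D i \<and> (i = 1 \<or> \<not> D (i - 1)) then \<alpha> else 1) *
       (if i \<noteq> 1 \<and> D (i - 1) \<and> \<not> D i then \<beta> else 1) * (if D i then \<gamma> else 1))"
    by (intro prod.cong) (auto simp: step_wt_def)
  also have "\<dots> = \<alpha> ^ card {i \<in> {1..k}. D i \<and> (i = 1 \<or> \<not> D (i - 1))} *
      \<beta> ^ card {i \<in> {1..k}. i \<noteq> 1 \<and> D (i - 1) \<and> \<not> D i} * \<gamma> ^ card {i \<in> {1..k}. D i}"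
    by (simp add: prod.distrib prod_if_eq_power_card)
  also have "{i \<in> {1..k}. D i \<and> (i = 1 \<or> \<not> D (i - 1))} = {i \<in> {1..Suc k-1}.
     (2 \<le> i \<and> \<pi> (i-1) < \<pi> i \<and> \<pi> i > \<pi> (i+1)) \<or> (i = 1 \<and> \<pi> 1 > \<pi> 2)}" (is "?A = ?B")
  proof (intro set_eqI)
    fix i show "i \<in> ?A \<longleftrightarrow> i \<in> ?B"
      using neq[of "i - 1"] by (cases "i \<le> 1") (auto simp: D_def numeral_2_eq_2 le_Suc_eq)
  qed
  also have "{i \<in> {1..k}. i \<noteq> 1 \<and> D (i - 1) \<and> \<not> D i} =
      {i \<in> {2..Suc k-1}. \<pi> (i-1) > \<pi> i \<and> \<pi> i < \<pi> (i+1)}" (is "?A = ?B")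
  proof (intro set_eqI)
    fix i show "i \<in> ?A \<longleftrightarrow> i \<in> ?B"
      using neq[of i] by (cases "i \<le> 1") (auto simp: D_def)
  qed
  also have "{i \<in> {1..k}. D i} = {i \<in> {1..Suc k-1}. \<pi> i > \<pi> (i+1)}"
    by (auto simp: D_def)
  finally show ?thesis by (simp add: lpk_def val_def des_def)
qed

lemma P_inv_lpk_val_des_codes:
  "P_inv_lpk_val_des (Suc k) q \<alpha> \<beta> \<gamma>
     = (\<Sum>d\<in>codes k. q ^ (\<Sum>j\<le>k. d j) * code_wt \<alpha> \<beta> \<gamma> False k d)"
proof -
  have "(\<Sum>d\<in>codes k. q ^ (\<Sum>j\<le>k. d j) * code_wt \<alpha> \<beta> \<gamma> False k d) =
      (\<Sum>\<pi> | \<pi> permutes {1..Suc k}. q ^ (\<Sum>j\<le>k. perm_code (Suc k) \<pi> j) *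
         code_wt \<alpha> \<beta> \<gamma> False k (perm_code (Suc k) \<pi>))"
    by (rule sum.reindex_bij_betw[OF perm_code_bij, symmetric])
  also have "\<dots> = P_inv_lpk_val_des (Suc k) q \<alpha> \<beta> \<gamma>"
    unfolding P_inv_lpk_val_des_def
    by (intro sum.cong)
      (auto simp: code_wt_perm_code invs_eq_sum_code lessThan_Suc_atMost mult.assoc simp del: One_nat_def)
  finally show ?thesis ..
qed

section \<open>The recurrence\<close>

text \<open>
  The generating function of the sequences \<open>c\<^sub>1 \<le> \<dots> \<le> c\<^sub>m \<le> a\<close> by their sum, which is the
  \<open>q\<close>-binomial coefficient of \<open>m + a\<close> over \<open>m\<close>.
\<close>

primrec boxsum :: "'a \<Rightarrow> nat \<Rightarrow> nat \<Rightarrow> 'a::comm_ring_1" where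
  "boxsum q 0 a = 1"
| "boxsum q (Suc m) a = (\<Sum>b\<le>a. q ^ b * boxsum q m b)"

lemma q_fact_0 [simp]: "q_fact q 0 = 1"
  by (simp add: q_fact_def)

lemma q_fact_Suc: "q_fact q (Suc n) = q_fact q n * (\<Sum>i<Suc n. q ^ i)"
  by (simp add: q_fact_def)

lemma sum_power_append:
  "(\<Sum>i<a + b. (q::'a::comm_ring_1) ^ i) = (\<Sum>i<a. q ^ i) + q ^ a * (\<Sum>i<b. q ^ i)"
  by (induction b) (auto simp: power_add algebra_simps)

lemma boxsum_0 [simp]: "boxsum q m 0 = 1"
  by (induction m) auto

text \<open>Induction by the q-Pascal rule: the largest part is at most \<open>a\<close>, or it
  equals \<open>a + 1\<close> and is split off. The product form avoids division.\<close>

lemma boxsum_q_fact: "boxsum q m a * (q_fact q m * q_fact q a) = q_fact q (m + a)"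
proof (induction m arbitrary: a)
  case (Suc m)
  note IHm = this
  show ?case
  proof (induction a)
    case 0
    show ?case by (simp del: boxsum.simps)
  next
    case (Suc a)
    have "boxsum q (Suc m) (Suc a) * (q_fact q (Suc m) * q_fact q (Suc a)) =
        boxsum q (Suc m) a * (q_fact q (Suc m) * q_fact q a) * (\<Sum>i<Suc a. q ^ i) +
        q ^ Suc a * (boxsum q m (Suc a) * (q_fact q m * q_fact q (Suc a))) * (\<Sum>i<Suc m. q ^ i)"
      by (simp only: boxsum.simps(2) sum.atMost_Suc q_fact_Suc) (simp only: algebra_simps)
    also have "\<dots> = q_fact q (m + Suc a) * ((\<Sum>i<Suc a. q ^ i) + q ^ Suc a * (\<Sum>i<Suc m. q ^ i))"
      unfolding Suc IHm by (simp only: add_Suc_right add_Suc algebra_simps)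
    also have "\<dots> = q_fact q (Suc m + Suc a)"
      unfolding sum_power_append[symmetric] by (simp only: add_Suc_right add_Suc q_fact_Suc add.commute)
    finally show ?case .
  qed
qed auto

text \<open>
  Counts codes with \<open>m\<close> further letters in front that increase weakly up to the first letter of
  the code; these contribute to the power of \<open>q\<close> but carry no step weight.
\<close>

definition code_sum :: "'a \<Rightarrow> 'a \<Rightarrow> 'a \<Rightarrow> 'a \<Rightarrow> nat \<Rightarrow> nat \<Rightarrow> bool \<Rightarrow> 'a::comm_ring_1" where
  "code_sum q \<alpha> \<beta> \<gamma> m k s =
     (\<Sum>d\<in>codes k. q ^ (\<Sum>j\<le>k. d j) * code_wt \<alpha> \<beta> \<gamma> s k d * boxsum q m (d k))"

lemma code_sum_0: "code_sum q \<alpha> \<beta> \<gamma> m 0 s = 1"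
proof -
  have "code_sum q \<alpha> \<beta> \<gamma> m 0 s = (\<Sum>d\<in>codes 0. 1)"
    unfolding code_sum_def by (intro sum.cong) (auto simp: codes_def PiE_iff)
  then show ?thesis by (simp add: card_codes)
qed

text \<open>Split by comparing the new front letter \<open>a\<close> with \<open>d k\<close>. If
  \<open>a \<le> d k\<close>, it joins the \<open>m\<close> increasing letters. The descents are all
  choices minus these, and the sum over all choices does not depend on \<open>d\<close>, so it
  factors out.\<close>

lemma code_sum_Suc:
  "code_sum q \<alpha> \<beta> \<gamma> m (Suc k) s =
     step_wt \<alpha> \<beta> \<gamma> s False * code_sum q \<alpha> \<beta> \<gamma> (Suc m) k False +
     step_wt \<alpha> \<beta> \<gamma> s True * (boxsum q (Suc m) (Suc k) * code_sum q \<alpha> \<beta> \<gamma> 0 k True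
       - code_sum q \<alpha> \<beta> \<gamma> (Suc m) k True)"
proof -
  let ?w = "step_wt \<alpha> \<beta> \<gamma>" and ?W = "code_wt \<alpha> \<beta> \<gamma>"
  have inner: "(\<Sum>a\<le>Suc k. q ^ (\<Sum>j\<le>Suc k. (d(Suc k := a)) j) * ?W s (Suc k) (d(Suc k := a)) *
        boxsum q m ((d(Suc k := a)) (Suc k)))
     = q ^ (\<Sum>j\<le>k. d j) * (?w s False * ?W False k d * boxsum q (Suc m) (d k)
       + ?w s True * ?W True k d * (boxsum q (Suc m) (Suc k) - boxsum q (Suc m) (d k)))"
    (is "?lhs = _") if d: "d \<in> codes k" for d
  proof -
    have dk: "d k \<le> k" using d by (auto simp: codes_def)
    let ?Q = "q ^ (\<Sum>j\<le>k. d j)"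
    define x where "x = ?Q * (?w s False * ?W False k d)"
    define y where "y = ?Q * (?w s True * ?W True k d)"
    have split: "{..Suc k} = {..d k} \<union> {d k<..Suc k}" using dk by auto
    have "?lhs = (\<Sum>a\<le>Suc k. (if d k < a then y else x) * (q ^ a * boxsum q m a))"
      by (intro sum.cong) (auto simp: power_add x_def y_def algebra_simps)
    also have "\<dots> = (\<Sum>a\<le>d k. (if d k < a then y else x) * (q ^ a * boxsum q m a)) +
        (\<Sum>a\<in>{d k<..Suc k}. (if d k < a then y else x) * (q ^ a * boxsum q m a))"
      unfolding split by (rule sum.union_disjoint) auto
    also have "\<dots> = x * (\<Sum>a\<le>d k. q ^ a * boxsum q m a) + y * (\<Sum>a\<in>{d k<..Suc k}. q ^ a * boxsum q m a)"
      unfolding sum_distrib_left by (intro arg_cong2[where f="(+)"] sum.cong) auto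
    also have "(\<Sum>a\<in>{d k<..Suc k}. q ^ a * boxsum q m a) = boxsum q (Suc m) (Suc k) - boxsum q (Suc m) (d k)"
      unfolding boxsum.simps split by (subst sum.union_disjoint) auto
    also have "(\<Sum>a\<le>d k. q ^ a * boxsum q m a) = boxsum q (Suc m) (d k)"
      by simp
    finally show ?thesis unfolding x_def y_def by (simp only: algebra_simps)
  qed
  have "code_sum q \<alpha> \<beta> \<gamma> m (Suc k) s = (\<Sum>d\<in>codes k.
      q ^ (\<Sum>j\<le>k. d j) * (?w s False * ?W False k d * boxsum q (Suc m) (d k)
       + ?w s True * ?W True k d * (boxsum q (Suc m) (Suc k) - boxsum q (Suc m) (d k))))"
    unfolding code_sum_def sum_codes_Suc by (intro sum.cong refl inner)
  also have "\<dots> = ?w s False * code_sum q \<alpha> \<beta> \<gamma> (Suc m) k False +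
     ?w s True * (boxsum q (Suc m) (Suc k) * code_sum q \<alpha> \<beta> \<gamma> 0 k True
       - code_sum q \<alpha> \<beta> \<gamma> (Suc m) k True)"
    unfolding code_sum_def boxsum.simps(1) sum_distrib_left sum_subtractf[symmetric] sum.distrib[symmetric]
    by (intro sum.cong) (simp_all only: algebra_simps mult_1_left mult_1_right)
  finally show ?thesis .
qed

section \<open>Generating functions\<close>

text \<open>The index of \<open>q_fact\<close> is the total number of letters: \<open>k + 1\<close>
  in the code and \<open>m\<close> in front of it. Each step carries one factor
  \<open>c\<close>.\<close>

definition scaled_sum :: "'a \<Rightarrow> 'a \<Rightarrow> 'a \<Rightarrow> 'a \<Rightarrow> 'a \<Rightarrow> nat \<Rightarrow> nat \<Rightarrow> bool \<Rightarrow> 'a::field" where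
  "scaled_sum c q \<alpha> \<beta> \<gamma> m k s = c ^ k * code_sum q \<alpha> \<beta> \<gamma> m k s / q_fact q (Suc (m + k))"

definition code_fps :: "'a \<Rightarrow> 'a \<Rightarrow> 'a \<Rightarrow> 'a \<Rightarrow> 'a \<Rightarrow> bool \<Rightarrow> 'a::field fps" where
  "code_fps c q \<alpha> \<beta> \<gamma> s = Abs_fps (\<lambda>n. if n = 0 then 0 else scaled_sum c q \<alpha> \<beta> \<gamma> 0 (n - 1) s)"

text \<open>Division by the q-factorial splits the q-binomial coefficient into a factor in
  \<open>m\<close> and a factor in \<open>k\<close>; the latter is absorbed by
  \<open>scaled_sum\<close> at \<open>m = 0\<close>.\<close>

lemma scaled_sum_Suc:
  fixes q :: "'a::field"
  assumes nz: "\<And>n. q_fact q n \<noteq> 0"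
  shows "scaled_sum c q \<alpha> \<beta> \<gamma> m (Suc k) s =
     c * (step_wt \<alpha> \<beta> \<gamma> s False * scaled_sum c q \<alpha> \<beta> \<gamma> (Suc m) k False +
     step_wt \<alpha> \<beta> \<gamma> s True * (scaled_sum c q \<alpha> \<beta> \<gamma> 0 k True / q_fact q (Suc m)
       - scaled_sum c q \<alpha> \<beta> \<gamma> (Suc m) k True))"
proof -
  have "boxsum q (Suc m) (Suc k) / q_fact q (Suc (Suc (m + k))) = 1 / (q_fact q (Suc m) * q_fact q (Suc k))"
    using boxsum_q_fact[of q "Suc m" "Suc k"] nz by (simp add: field_simps del: boxsum.simps)
  then have "boxsum q (Suc m) (Suc k) = q_fact q (Suc (Suc (m + k))) / (q_fact q (Suc m) * q_fact q (Suc k))"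
    using nz by (simp add: field_simps del: boxsum.simps)
  then show ?thesis
    using nz unfolding scaled_sum_def code_sum_Suc
    by (simp add: field_simps del: boxsum.simps)
qed

text \<open>
  \<open>(l\<^sub>0, l\<^sub>1)\<close> is a left eigenvector of \<open>c\<close> times the difference of the ascent and the descent
  transfer matrices. Since the descent matrix has rank one, projecting the recurrence
  to it leaves a scalar convolution.
\<close>

lemma code_fps_eigen:
  fixes q :: "'a::field"
  assumes nz: "\<And>n. q_fact q n \<noteq> 0"
    and eig0: "c * (l0 + l1 * \<beta>) = ev * l0"
    and eig1: "- (c * \<gamma> * (l0 * \<alpha> + l1)) = ev * l1"
  shows "fps_const ev * (fps_const l0 * code_fps c q \<alpha> \<beta> \<gamma> False + fps_const l1 * code_fps c q \<alpha> \<beta> \<gamma> True)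
    = (fps_compose (q_exp q) (fps_const ev * fps_X) - 1) *
      (fps_const (l0 + l1) - fps_const (ev * l1) * code_fps c q \<alpha> \<beta> \<gamma> True)"
proof -
  let ?S = "scaled_sum c q \<alpha> \<beta> \<gamma>"
  define e where "e m k = l0 * ?S m k False + l1 * ?S m k True" for m k
  have e_0: "e m 0 = (l0 + l1) / q_fact q (Suc m)" for m
    by (simp add: e_def scaled_sum_def code_sum_0 add_divide_distrib)
  have e_Suc: "e m (Suc k) = ev * e (Suc m) k - ev * l1 * ?S 0 k True / q_fact q (Suc m)" for m k
  proof -
    \<comment> \<open>Here \<open>X\<close> is the rank-one term. Collecting the coefficients of
      \<open>A\<close> and of \<open>B - X\<close> exposes the two eigenvector equations.\<close>
    have ring: "l0 * (c * (1 * A + \<alpha> * \<gamma> * (X - B))) + l1 * (c * (\<beta> * A + \<gamma> * (X - B))) =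
        (c * (l0 + l1 * \<beta>)) * A + (- (c * \<gamma> * (l0 * \<alpha> + l1))) * (B - X)" for A B X
      by (simp add: algebra_simps)
    have "e m (Suc k) = (c * (l0 + l1 * \<beta>)) * ?S (Suc m) k False
        + (- (c * \<gamma> * (l0 * \<alpha> + l1))) * (?S (Suc m) k True - ?S 0 k True / q_fact q (Suc m))"
      unfolding e_def scaled_sum_Suc[OF nz] step_wt_def
      by (simp only: if_True if_False ring)
    then show ?thesis
      unfolding eig0 eig1 e_def by (simp add: algebra_simps)
  qed
  \<comment> \<open>Iterating \<open>e_Suc\<close> trades code letters for front letters; round
    \<open>j\<close> releases one term of the sum, and \<open>e_0\<close> ends the process.\<close>
  have e: "e m k = (l0 + l1) * ev ^ k / q_fact q (Suc (m + k))
      - (\<Sum>j<k. ev ^ Suc j / q_fact q (Suc (m + j)) * (l1 * ?S 0 (k - Suc j) True))" for m k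
  proof (induction k arbitrary: m)
    case (Suc k)
    show ?case
      unfolding e_Suc Suc.IH sum.lessThan_Suc_shift
      by (simp add: algebra_simps sum_distrib_left)
  qed (simp add: e_0)
  show ?thesis
  proof (rule fps_ext)
    fix n
    show "(fps_const ev * (fps_const l0 * code_fps c q \<alpha> \<beta> \<gamma> False + fps_const l1 * code_fps c q \<alpha> \<beta> \<gamma> True)) $ n
    = ((fps_compose (q_exp q) (fps_const ev * fps_X) - 1) *
      (fps_const (l0 + l1) - fps_const (ev * l1) * code_fps c q \<alpha> \<beta> \<gamma> True)) $ n"
    proof (cases n)
      case 0
      then show ?thesis by (simp add: code_fps_def q_exp_def)
    next
      case (Suc k)
      let ?A = "fps_compose (q_exp q) (fps_const ev * fps_X) - 1"
      let ?B = "fps_const (l0 + l1) - fps_const (ev * l1) * code_fps c q \<alpha> \<beta> \<gamma> True"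
      have A0: "?A $ 0 = 0" by (simp add: q_exp_def)
      have AS: "?A $ Suc j = ev ^ Suc j / q_fact q (Suc j)" for j by (simp add: q_exp_def)
      have B0: "?B $ 0 = l0 + l1" by (simp add: code_fps_def)
      have BS: "?B $ Suc j = - (ev * l1 * ?S 0 j True)" for j by (simp add: code_fps_def)
      have "(?A * ?B) $ Suc k = (\<Sum>i=0..Suc k. ?A $ i * ?B $ (Suc k - i))"
        by (rule fps_mult_nth)
      also have "\<dots> = (\<Sum>j\<le>k. ?A $ Suc j * ?B $ (k - j))"
        by (simp only: atMost_atLeast0[symmetric] sum.atMost_Suc_shift A0) simp
      \<comment> \<open>The term at \<open>?B $ 0\<close> is the contribution of the base case; the
        others form the convolution in \<open>e\<close> at \<open>m = 0\<close>.\<close>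
      also have "\<dots> = (\<Sum>j<k. ?A $ Suc j * ?B $ Suc (k - Suc j)) + ?A $ Suc k * ?B $ 0"
        by (simp add: lessThan_Suc_atMost[symmetric] Suc_diff_Suc del: fps_sub_nth fps_nth_compose_linear)
      also have "\<dots> = ev * e 0 k"
        unfolding AS B0 BS e by (simp add: algebra_simps sum_distrib_left sum_negf)
      finally show ?thesis using Suc by (simp add: code_fps_def e_def)
    qed
  qed
qed

section \<open>Reciprocity of the two q-exponentials\<close>

text \<open>A vanishing factor \<open>1 + q + ... + q^(k-1)\<close>, multiplied by
  \<open>1 - q\<close>, would give \<open>q^k = 1\<close>.\<close>

lemma q_fact_neq_0:
  fixes q :: "'a::field"
  assumes "\<And>n. n > 0 \<Longrightarrow> q ^ n \<noteq> 1"
  shows "q_fact q n \<noteq> 0"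
proof -
  have "(\<Sum>i<k. q ^ i) \<noteq> 0" if "k > 0" for k
    using assms[OF that] one_diff_power_eq[of q k] by auto
  then show ?thesis by (simp add: q_fact_def)
qed

text \<open>
  The substitution \<open>x \<mapsto> q x\<close> multiplies the first factor by \<open>1 + (1 - q) y x\<close> and divides the
  second one by it, so it fixes the product, which must therefore be constant.
\<close>

lemma q_exp_mult_q_Exp:
  fixes q :: "'a::field"
  assumes q: "\<And>n. n > 0 \<Longrightarrow> q ^ n \<noteq> 1"
  shows "fps_compose (q_exp q) (fps_const (-y) * fps_X) * fps_compose (q_Exp q) (fps_const y * fps_X) = 1"
proof -
  define H where "H = fps_compose (q_exp q) (fps_const (-y) * fps_X)"
  define E where "E = fps_compose (q_Exp q) (fps_const y * fps_X)"
  define r where "r = 1 + fps_const ((1 - q) * y) * fps_X"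
  define \<sigma> where "\<sigma> f = fps_compose f (fps_const q * fps_X)" for f :: "'a fps"
  note nz = q_fact_neq_0[of q, OF q]
  have fact_Suc: "(1 - q) * q_fact q (Suc n) = q_fact q n * (1 - q ^ Suc n)" for n
    unfolding q_fact_Suc one_diff_power_eq[of q "Suc n"] by (simp only: mult_ac)
  have fact_frac: "(1 - q) / q_fact q n = (1 - q ^ Suc n) / q_fact q (Suc n)" for n
    using fact_Suc[of n] nz[of n] nz[of "Suc n"] by (simp add: frac_eq_eq mult_ac del: power_Suc)
  have Hn: "H $ n = (-y) ^ n / q_fact q n" for n by (simp add: H_def q_exp_def)
  have En: "E $ n = y ^ n * q ^ (n choose 2) / q_fact q n" for n by (simp add: E_def q_Exp_def)
  have \<sigma>n: "\<sigma> f $ n = q ^ n * f $ n" for f n by (simp add: \<sigma>_def)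
  have r0: "(f * r) $ 0 = f $ 0" for f by (simp add: r_def)
  have rS: "(f * r) $ Suc m = f $ Suc m + (1 - q) * (y * f $ m)" for f m
    by (simp add: r_def ring_distribs mult.assoc[symmetric])
  have H: "\<sigma> H = H * r"
  proof (rule fps_ext)
    fix n show "\<sigma> H $ n = (H * r) $ n"
    proof (cases n)
      case (Suc m)
      have "(H * r) $ Suc m = (-y) ^ Suc m / q_fact q (Suc m) + y * (-y) ^ m * ((1 - q) / q_fact q m)"
        unfolding rS Hn by simp
      also have "\<dots> = ((-y) ^ Suc m + y * (-y) ^ m * (1 - q ^ Suc m)) / q_fact q (Suc m)"
        unfolding fact_frac by (simp only: add_divide_distrib times_divide_eq_right)
      also have "(-y) ^ Suc m + y * (-y) ^ m * (1 - q ^ Suc m) = q ^ Suc m * (-y) ^ Suc m"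
        by (simp add: algebra_simps)
      finally show ?thesis by (simp only: Suc \<sigma>n Hn times_divide_eq_right)
    qed (simp only: \<sigma>n r0, simp)
  qed
  have E: "E = \<sigma> E * r"
  proof (rule fps_ext)
    fix n show "E $ n = (\<sigma> E * r) $ n"
    proof (cases n)
      case (Suc m)
      define z where "z = y ^ Suc m * q ^ (Suc m choose 2)"
      have z: "y * (q ^ m * (y ^ m * q ^ (m choose 2))) = z"
        by (simp add: z_def numeral_2_eq_2 power_add)
      have "(\<sigma> E * r) $ Suc m = q ^ Suc m * z / q_fact q (Suc m)
          + y * (q ^ m * (y ^ m * q ^ (m choose 2))) * ((1 - q) / q_fact q m)"
        unfolding rS \<sigma>n En z_def by simp
      also have "\<dots> = (q ^ Suc m * z + z * (1 - q ^ Suc m)) / q_fact q (Suc m)"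
        unfolding fact_frac z by (simp only: add_divide_distrib times_divide_eq_right)
      also have "q ^ Suc m * z + z * (1 - q ^ Suc m) = z"
        by (simp add: algebra_simps)
      finally show ?thesis by (simp only: Suc En z_def)
    qed (simp only: \<sigma>n r0, simp)
  qed
  have "\<sigma> (H * E) = \<sigma> H * \<sigma> E"
    unfolding \<sigma>_def by (rule fps_compose_mult_distrib) simp
  also have "\<dots> = H * E"
    unfolding H by (subst (2) E) (simp only: mult_ac)
  finally have fixed: "\<sigma> (H * E) = H * E" .
  have "(H * E) $ n = 0" if "n > 0" for n
  proof -
    \<comment> \<open>Invariance leaves a factor \<open>q ^ n - 1\<close> at this coefficient, which
      is nonzero.\<close>
    have "q ^ n * (H * E) $ n = (H * E) $ n"
      using arg_cong[OF fixed, of "\<lambda>f. f $ n"] by (simp add: \<sigma>_def)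
    then show ?thesis using q[OF that] by (metis mult_cancel_right1 mult.commute)
  qed
  moreover have "(H * E) $ 0 = 1"
    by (simp add: Hn En numeral_2_eq_2)
  ultimately have "H * E = 1"
    by (intro fps_ext) (metis fps_one_nth neq0_conv)
  then show ?thesis unfolding H_def E_def .
qed

section \<open>Elimination between the two eigenvector equations\<close>

text \<open>Working in an arbitrary field reduces the properties of the indeterminates to finitely
  many nonvanishing conditions and \<open>q\<close> not being a root of unity.\<close>

lemma inv_lpk_val_des_fps:
  fixes q y t \<alpha> \<beta> \<gamma> :: "'a::field"
  assumes q: "\<And>n. n > 0 \<Longrightarrow> q ^ n \<noteq> 1"
    and nz: "y \<noteq> 0" "1 - t^2 \<noteq> 0" "y + t \<noteq> 0" "1 + y * t \<noteq> 0" "1 + y * t^2 \<noteq> 0" "y + t^2 \<noteq> 0"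
    and \<alpha>: "\<alpha> = t * (1 + y) * (y + t) / ((y + t^2) * (1 + y * t))"
    and \<beta>: "\<beta> = t * (1 + y) * (1 + y * t) / ((1 + y * t^2) * (y + t))"
    and \<gamma>: "\<gamma> = (y + t^2) / (1 + y * t^2)"
  shows "fps_const (1 - t) * (1 + fps_const t * q_exp q)
           / (1 - fps_const (t^2) * q_exp q * fps_compose (q_Exp q) (fps_const y * fps_X))
         = 1 + fps_const (t * (1 + y * t)) *
             Abs_fps (\<lambda>n. if n = 0 then 0
               else (1 + y * t^2) ^ (n - 1) / (1 - t^2) ^ n
                      * P_inv_lpk_val_des n q \<alpha> \<beta> \<gamma> / q_fact q n)"
    (is "?N / ?D = ?R")
proof -
  define c where "c = (1 + y * t^2) / (1 - t^2)"
  define H where "H = q_exp q"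
  define H' where "H' = fps_compose (q_exp q) (fps_const (-y) * fps_X)"
  define E where "E = fps_compose (q_Exp q) (fps_const y * fps_X)"
  \<comment> \<open>The factors \<open>1 + y * t\<close> and \<open>y + t\<close> are common to both
    eigenvectors; absorbing them leaves only \<open>T\<close> as coefficient.\<close>
  define u where "u = fps_const (1 + y * t) * code_fps c q \<alpha> \<beta> \<gamma> False"
  define d where "d = fps_const (y + t) * code_fps c q \<alpha> \<beta> \<gamma> True"
  define T where "T = fps_const t"
  define k where "k = fps_const (1 - t^2)"
  note fact_nz = q_fact_neq_0[of q, OF q]
  have c\<beta>: "c * \<beta> = t * (1 + y) * (1 + y * t) / ((1 - t^2) * (y + t))"
    using nz by (simp add: c_def \<beta>)
  have c\<gamma>: "c * \<gamma> = (y + t^2) / (1 - t^2)"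
    using nz by (simp add: c_def \<gamma>)
  have c\<gamma>\<alpha>: "c * \<gamma> * \<alpha> = t * (1 + y) * (y + t) / ((1 - t^2) * (1 + y * t))"
    using nz by (simp add: c\<gamma> \<alpha>)
  have add_frac: "X / K * a + b * (Y / (K * L)) = (X * a * L + b * Y) / (K * L)"
    if "K \<noteq> 0" "L \<noteq> 0" for X Y K L a b :: 'a
    using that by (simp add: field_simps)
  \<comment> \<open>Clearing denominators turns the eigenvector equations into polynomial
    identities.\<close>
  have eig0: "c * (l0 + l1 * \<beta>) = ev * l0"
    if "(1 + y * t^2) * l0 * (y + t) + l1 * (t * (1 + y) * (1 + y * t)) = ev * l0 * ((1 - t^2) * (y + t))" for l0 l1 ev
  proof -
    have "c * (l0 + l1 * \<beta>) = c * l0 + l1 * (c * \<beta>)" by (simp add: algebra_simps)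
    also have "\<dots> = ((1 + y * t^2) * l0 * (y + t) + l1 * (t * (1 + y) * (1 + y * t))) / ((1 - t^2) * (y + t))"
      unfolding c\<beta> unfolding c_def by (rule add_frac) (use nz in simp_all)
    finally show ?thesis unfolding that using nz by simp
  qed
  have eig1: "- (c * \<gamma> * (l0 * \<alpha> + l1)) = ev * l1"
    if "(y + t^2) * l1 * (1 + y * t) + l0 * (t * (1 + y) * (y + t)) = - (ev * l1 * ((1 - t^2) * (1 + y * t)))" for l0 l1 ev
  proof -
    have "c * \<gamma> * (l0 * \<alpha> + l1) = (c * \<gamma>) * l1 + l0 * (c * \<gamma> * \<alpha>)" by (simp add: algebra_simps)
    also have "\<dots> = ((y + t^2) * l1 * (1 + y * t) + l0 * (t * (1 + y) * (y + t))) / ((1 - t^2) * (1 + y * t))"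
      unfolding c\<gamma>\<alpha> unfolding c\<gamma> by (rule add_frac) (use nz in simp_all)
    finally show ?thesis unfolding that using nz by simp
  qed
  \<comment> \<open>Eigenvalue 1 with left eigenvector
    \<open>(1 + y * t, - (t * (y + t)))\<close>.\<close>
  have "fps_const 1 * (fps_const (1 + y * t) * code_fps c q \<alpha> \<beta> \<gamma> False +
        fps_const (- (t * (y + t))) * code_fps c q \<alpha> \<beta> \<gamma> True)
    = (fps_compose (q_exp q) (fps_const 1 * fps_X) - 1) *
      (fps_const ((1 + y * t) + (- (t * (y + t)))) - fps_const (1 * (- (t * (y + t)))) * code_fps c q \<alpha> \<beta> \<gamma> True)"
    by (rule code_fps_eigen[OF fact_nz eig0 eig1]) (simp_all add: algebra_simps power2_eq_square)
  also have "(1 + y * t) + (- (t * (y + t))) = 1 - t^2"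
    by (simp add: algebra_simps power2_eq_square)
  finally have eq1: "u - T * d = (H - 1) * (k + T * d)"
    unfolding u_def d_def T_def H_def k_def
    by (simp add: mult.assoc[symmetric] del: fps_const_add fps_const_sub)
       (simp add: fps_const_neg[symmetric] del: fps_const_neg)
  \<comment> \<open>Eigenvalue \<open>-y\<close> with left eigenvector
    \<open>(t * (1 + y * t), - (y + t))\<close>. Its entries sum to \<open>-y * (1 - t^2)\<close>,
    so a factor \<open>-y\<close> cancels on both sides.\<close>
  have "fps_const (-y) * (fps_const (t * (1 + y * t)) * code_fps c q \<alpha> \<beta> \<gamma> False +
        fps_const (- (y + t)) * code_fps c q \<alpha> \<beta> \<gamma> True)
    = (fps_compose (q_exp q) (fps_const (-y) * fps_X) - 1) *
      (fps_const (t * (1 + y * t) + (- (y + t))) - fps_const ((-y) * (- (y + t))) * code_fps c q \<alpha> \<beta> \<gamma> True)"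
    by (rule code_fps_eigen[OF fact_nz eig0 eig1]) (simp_all add: algebra_simps power2_eq_square)
  also have "t * (1 + y * t) + (- (y + t)) = (-y) * (1 - t^2)"
    by (simp add: algebra_simps power2_eq_square)
  also have "fps_const ((-y) * (1 - t^2)) - fps_const ((-y) * (- (y + t))) * code_fps c q \<alpha> \<beta> \<gamma> True
     = fps_const (-y) * (k + d)"
    unfolding k_def d_def fps_const_mult[symmetric] fps_const_neg[symmetric, of "y + t"]
    by (simp only: ring_distribs mult_ac mult_minus_left mult_minus_right diff_minus_eq_add)
  also have "fps_const (t * (1 + y * t)) * code_fps c q \<alpha> \<beta> \<gamma> False +
        fps_const (- (y + t)) * code_fps c q \<alpha> \<beta> \<gamma> True = T * u - d"
    unfolding T_def u_def d_def fps_const_mult[symmetric] fps_const_neg[symmetric]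
    by (simp only: mult.assoc mult_minus_left) simp
  finally have "fps_const (-y) * (T * u - d) = fps_const (-y) * ((H' - 1) * (k + d))"
    unfolding H'_def by (simp only: mult_ac)
  moreover have "fps_const (-y) \<noteq> 0" using nz by simp
  ultimately have eq2: "T * u - d = (H' - 1) * (k + d)"
    by (metis mult_left_cancel)
  have HE: "H' * E = 1"
    unfolding H'_def E_def by (rule q_exp_mult_q_Exp[OF q])
  have k: "k = 1 - T * T"
    unfolding k_def T_def by (simp add: power2_eq_square)
  have d: "k + d = E * (T * u + k)"
  proof -
    have "E * (T * u + k) = (H' * E) * (k + d)"
      using arg_cong[OF eq2, of "\<lambda>f. E * f"] by (simp add: algebra_simps)
    then show ?thesis by (simp add: HE)
  qed
  have u: "u + k = H * (k + T * d)" using eq1 by (simp add: algebra_simps)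
  \<comment> \<open>The powers of \<open>c\<close> in \<open>u\<close> supply only
    \<open>n - 1\<close> factors \<open>1 / (1 - t^2)\<close>; this is the missing one.\<close>
  define v where "v = fps_const (1 / (1 - t^2)) * u"
  have kv: "k * v = u"
    using nz by (simp add: v_def k_def mult.assoc[symmetric])
  have R: "?R = 1 + T * v"
  proof -
    have "fps_const (t * (1 + y * t)) * Abs_fps (\<lambda>n. if n = 0 then 0
               else (1 + y * t^2) ^ (n - 1) / (1 - t^2) ^ n
                      * P_inv_lpk_val_des n q \<alpha> \<beta> \<gamma> / q_fact q n) = T * v"
    proof (rule fps_ext)
      fix n
      show "(fps_const (t * (1 + y * t)) * Abs_fps (\<lambda>n. if n = 0 then 0
               else (1 + y * t^2) ^ (n - 1) / (1 - t^2) ^ n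
                      * P_inv_lpk_val_des n q \<alpha> \<beta> \<gamma> / q_fact q n)) $ n = (T * v) $ n"
        using nz
        by (cases n) (auto simp: T_def v_def u_def code_fps_def scaled_sum_def code_sum_def
            P_inv_lpk_val_des_codes c_def power_divide mult_ac)
    qed
    then show ?thesis by simp
  qed
  have "k * ((1 + T * v) * (1 - T * T * H * E)) = k * ((1 - T) * (1 + T * H))"
  proof -
    \<comment> \<open>Substituting \<open>d\<close> from the second equation into the first leaves
      an equation linear in \<open>u\<close>.\<close>
    have "u + k = H * (k + T * (E * (T * u + k) - k))"
      using u d by (metis add_diff_cancel_left')
    then have cancel: "u * (1 - T * T * H * E) = k * (H + T * H * E - T * H - 1)"
      by (simp add: algebra_simps)
    have "(k + T * u) * X = k * X + T * (u * X)" for X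
      by (simp add: algebra_simps)
    then have "(k + T * u) * (1 - T * T * H * E)
        = k * (1 - T * T * H * E) + T * (k * (H + T * H * E - T * H - 1))"
      by (simp only: cancel)
    also have "\<dots> = k * ((1 - T) * (1 + T * H))"
      by (simp add: algebra_simps)
    finally show ?thesis unfolding kv[symmetric] by (simp only: ring_distribs mult_ac mult_1_left mult_1_right)
  qed
  moreover have "k \<noteq> 0" using nz by (simp add: k_def)
  ultimately have main: "(1 + T * v) * (1 - T * T * H * E) = (1 - T) * (1 + T * H)"
    by (metis mult_left_cancel)
  have N: "?N = (1 - T) * (1 + T * H)"
    by (simp add: T_def H_def)
  have D: "?D = 1 - T * T * H * E"
    by (simp add: T_def H_def E_def power2_eq_square)
  \<comment> \<open>The constant coefficient of the denominator is \<open>1 - t^2\<close>.\<close>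
  have "?D $ 0 \<noteq> 0" using nz by (simp add: q_exp_def q_Exp_def binomial_eq_0)
  then have "?D \<noteq> 0" by (metis fps_zero_nth)
  then show ?thesis
    unfolding R N main[symmetric] D[symmetric] by (rule nonzero_mult_div_cancel_right)
qed

section \<open>Specialization to the field of rational functions\<close>

theorem theorem4p16:
  fixes q y t \<alpha> \<beta> \<gamma> :: ratfun
  assumes "q = ind_q" and "y = ind_y" and "t = ind_t"
    and "\<alpha> = t * (1 + y) * (y + t) / ((y + t^2) * (1 + y * t))"
    and "\<beta> = t * (1 + y) * (1 + y * t) / ((1 + y * t^2) * (y + t))"
    and "\<gamma> = (y + t^2) / (1 + y * t^2)"
  shows "fps_const (1 - t) * (1 + fps_const t * q_exp q)
           / (1 - fps_const (t^2) * q_exp q * fps_compose (q_Exp q) (fps_const y * fps_X))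
         = 1 + fps_const (t * (1 + y * t)) *
             Abs_fps (\<lambda>n. if n = 0 then 0
               else (1 + y * t^2) ^ (n - 1) / (1 - t^2) ^ n
                      * P_inv_lpk_val_des n q \<alpha> \<beta> \<gamma> / q_fact q n)"
proof (rule inv_lpk_val_des_fps[OF _ _ _ _ _ _ _ assms(4-6)])
  fix n :: nat assume n: "n > 0"
  \<comment> \<open>Powers of \<open>ind_q\<close> stay in the innermost polynomial ring, where the
    degree \<open>n\<close> distinguishes them from 1.\<close>
  have pow: "ind_q ^ n = to_fract [:[:[:0, 1:] ^ n:]:]" for n
    by (induction n) (simp_all add: ind_q_def one_pCons flip: to_fract_mult to_fract_1)
  have "[:0, 1::rat:] ^ n \<noteq> 1"
    using n by (metis degree_1 degree_linear_power neq0_conv)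
  then have "[:[:[:0, 1::rat:] ^ n:]:] \<noteq> 1"
    by (simp add: one_pCons)
  then show "q ^ n \<noteq> 1"
    unfolding assms(1) pow by (metis to_fract_1 to_fract_eq_iff)
\<comment> \<open>Each remaining condition says that an explicit polynomial in \<open>y\<close> and
  \<open>t\<close>, embedded by \<open>to_fract\<close>, is nonzero.\<close>
qed (simp_all add: assms(2,3) ind_y_def ind_t_def power2_eq_square one_pCons
      flip: to_fract_mult to_fract_1 to_fract_add to_fract_diff)

end
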